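(* Let $i\in\{1,2\}$ and $u\in X_i$. Then $$\int_\Omega(-\Delta)^{s_i(x,\cdot)}_{a^i_{(x,\cdot)}}u(x)\,dx=-\int_{\mathbb{R}^N\setminus\Omega}\mathcal{N}^{s_i(x,\cdot)}_{a^i(x,\cdot)}u(x)\,dx .$$
   Context: Setting. $N\ge1$, $\Omega\subset\mathbb{R}^N$ is open and bounded with Lipschitz boundary, $C\Omega:=\mathbb{R}^N\setminus\Omega$, $\beta\in L^\infty(C\Omega)$ with $\beta\ge0$. For $i=1,2$: - $s_i:\mathbb{R}^N\times\mathbb{R}^N\to(0,1)$ is continuous, symmetric, with $0<s_i^-:=\inf s_i\le s_i^+:=\sup s_i<1$. - $a^i:\mathbb{R}^N\times\mathbb{R}^N\times\mathbb{R}\to\mathbb{R}$, $a^i_{(x,y)}(t):=a^i(x,y,t)$, satisfies $a^i(x,y,t)=a^i(y,x,t)$, and $\varphi^i_{x,y}(t):=a^i(x,y,|t|)t$ for $t\ne0$, $\varphi^i_{x,y}(0):=0$, is an increasing homeomorphism of $\mathbb{R}$ onto itself. Put $\Phi^i_{x,y}(t):=\int_0^t\varphi^i_{x,y}(\tau)\,d\tau$ for $t\ge0$ and $\widehat\Phi^i_x:=\Phi^i_{x,x}$. These are Musielak functions (in particular measurable in the space variables). - There are constants $\varphi_i^\pm$ with $1<\varphi_i^-\le \dfrac{t\varphi^i_{x,y}(t)}{\Phi^i_{x,y}(t)}\le\varphi_i^+<\infty$ for all $(x,y)$ and all $t>0$; and $t\mapsto\Phi^i_{x,y}(\sqrt t)$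 is convex on $[0,\infty)$. Function space. For measurable $u:\mathbb{R}^N\to\mathbb{R}$ let $\|u\|_{X_i}:=[u]_{s_i(x,y),\Phi^i_{x,y}}+\|u\|_{\widehat\Phi^i_x}+\|u\|_{\widehat\Phi^i_x,\beta,C\Omega}$, where $[u]_{s_i(x,y),\Phi^i_{x,y}}=\inf\{\lambda>0:\int_{\mathbb{R}^{2N}\setminus(C\Omega)^2}\Phi^i_{x,y}\big(\tfrac{|u(x)-u(y)|}{\lambda|x-y|^{s_i(x,y)}}\big)\tfrac{dx\,dy}{|x-y|^N}\le1\}$, $\|u\|_{\widehat\Phi^i_x}=\inf\{\lambda>0:\int_\Omega\widehat\Phi^i_x(|u(x)|/\lambda)\,dx\le1\}$, $\|u\|_{\widehat\Phi^i_x,\beta,C\Omega}=\inf\{\lambda>0:\int_{C\Omega}\beta(x)\widehat\Phi^i_x(|u(x)|/\lambda)\,dx\le1\}$. $X_i$ is the space of measurable $u:\mathbb{R}^N\to\mathbb{R}$ with $\|u\|_{X_i}<\infty$ (a.e. equal functions identified). Operators. With $k^i_u(x,y):=a^i_{(x,y)}\Big(\tfrac{|u(x)-u(y)|}{|x-y|^{s_i(x,y)}}\Big)\tfrac{u(x)-u(y)}{|x-y|^{s_i(x,y)}}\tfrac{1}{|x-y|^{N+s_i(x,y)}}$, $$(-\Delta)^{s_i(x,\cdot)}_{a^i_{(x,\cdot)}}u(x):=\lim_{\varepsilon\searrow0}\int_{\mathbb{R}^N\setminus B_\varepsilon(x)}k^i_u(x,y)\,dy,\qquad \mathcal{N}^{s_i(x,\cdot)}_{a^i(x,\cdot)}u(x):=\int_\Omega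 k^i_u(x,y)\,dy\quad(x\in\mathbb{R}^N\setminus\Omega).$$
   Formalization: Four added assumptions: the kernel k_u is absolutely integrable on Ω×Ω away from the diagonal and on (R^N∖Ω)×Ω; the principal value limit exists for a.e. x in Ω, and it also holds in L^1(Ω). Without them the identity can fail for u in X_i. *)

theory Defs
  imports "HOL-Analysis.Analysis"
begin

text \<open>
  The ambient space is a type \<open>'a\<close> of class \<open>euclidean_space\<close>, so that N is \<open>DIM('a)\<close>.
  "Measurable" and "almost everywhere" refer to the completed measure \<open>lebesgue\<close>.
\<close>

subsection \<open>Domain and weight\<close>

text \<open>
  Coordinate-free form of "locally the region above a Lipschitz graph": near p the domain is
  the part above a graph over the hyperplane orthogonal to the unit vector e.
\<close>

definition lipschitz_boundary :: "'a::euclidean_space set \<Rightarrow> bool" where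
  "lipschitz_boundary \<Omega> \<longleftrightarrow>
     (\<forall>p\<in>frontier \<Omega>. \<exists>e r L \<gamma>. norm e = 1 \<and> r > 0 \<and> L-lipschitz_on {v. v \<bullet> e = 0} \<gamma> \<and>
        \<Omega> \<inter> ball p r = {x \<in> ball p r. \<gamma> (x - (x \<bullet> e) *\<^sub>R e) < x \<bullet> e})"

definition bounded_weight :: "'a::euclidean_space set \<Rightarrow> ('a \<Rightarrow> real) \<Rightarrow> bool" where
  "bounded_weight A \<beta> \<longleftrightarrow>
     \<beta> \<in> borel_measurable (lebesgue_on A) \<and>
     (\<exists>C. AE x in lebesgue_on A. \<bar>\<beta> x\<bar> \<le> C) \<and>
     (AE x in lebesgue_on A. 0 \<le> \<beta> x)"

subsection \<open>Variable order and growth\<close>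

definition fractional_order :: "('a::euclidean_space \<Rightarrow> 'a \<Rightarrow> real) \<Rightarrow> bool" where
  "fractional_order s \<longleftrightarrow>
     (\<forall>x y. s x y \<in> {0<..<1}) \<and>
     continuous_on UNIV (\<lambda>(x, y). s x y) \<and>
     (\<forall>x y. s x y = s y x) \<and>
     0 < (INF (x, y). s x y) \<and> (SUP (x, y). s x y) < 1"

definition phi :: "('a \<Rightarrow> 'a \<Rightarrow> real \<Rightarrow> real) \<Rightarrow> 'a \<Rightarrow> 'a \<Rightarrow> real \<Rightarrow> real" where
  "phi a x y t = (if t = 0 then 0 else a x y \<bar>t\<bar> * t)"

text \<open>\<open>Phi\<close> is only used for nonnegative last argument.\<close>

definition Phi :: "('a \<Rightarrow> 'a \<Rightarrow> real \<Rightarrow> real) \<Rightarrow> 'a \<Rightarrow> 'a \<Rightarrow> real \<Rightarrow> real" where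
  "Phi a x y t = integral {0..t} (phi a x y)"

abbreviation Phi_hat :: "('a \<Rightarrow> 'a \<Rightarrow> real \<Rightarrow> real) \<Rightarrow> 'a \<Rightarrow> real \<Rightarrow> real" where
  "Phi_hat a x \<equiv> Phi a x x"

definition N_function :: "(real \<Rightarrow> real) \<Rightarrow> bool" where
  "N_function F \<longleftrightarrow>
     F 0 = 0 \<and> (\<forall>t>0. F t > 0) \<and> convex_on {0..} F \<and> continuous_on {0..} F \<and>
     ((\<lambda>t. F t / t) \<longlongrightarrow> 0) (at_right 0) \<and> filterlim (\<lambda>t. F t / t) at_top at_top"

definition musielak_function :: "('z::euclidean_space \<Rightarrow> real \<Rightarrow> real) \<Rightarrow> bool" where
  "musielak_function F \<longleftrightarrow>
     (\<forall>z. N_function (F z)) \<and> (\<forall>t\<ge>0. (\<lambda>z. F z t) \<in> borel_measurable lebesgue)"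

definition growth_conditions ::
  "('a::euclidean_space \<Rightarrow> 'a \<Rightarrow> real \<Rightarrow> real) \<Rightarrow> real \<Rightarrow> real \<Rightarrow> bool" where
  "growth_conditions a lo hi \<longleftrightarrow>
     (\<forall>x y t. a x y t = a y x t) \<and>
     (\<forall>x y. strict_mono (phi a x y) \<and> (\<exists>g. homeomorphism UNIV UNIV (phi a x y) g)) \<and>
     musielak_function (\<lambda>(x, y). Phi a x y) \<and> musielak_function (Phi_hat a) \<and>
     1 < lo \<and>
     (\<forall>x y. \<forall>t>0. lo \<le> t * phi a x y t / Phi a x y t \<and> t * phi a x y t / Phi a x y t \<le> hi) \<and>
     (\<forall>x y. convex_on {0..} (\<lambda>t. Phi a x y (sqrt t)))"

subsection \<open>Function space\<close>

text \<open>
  Luxemburg functional of a modular \<open>\<rho>\<close>, where \<open>\<rho> c\<close> is the modular of u divided by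
  \<open>c\<close>. It is \<open>\<infinity>\<close> if no \<open>c\<close> is admissible.
\<close>

definition luxemburg :: "(real \<Rightarrow> ennreal) \<Rightarrow> ennreal" where
  "luxemburg \<rho> = (INF c\<in>{c. c > 0 \<and> \<rho> c \<le> 1}. ennreal c)"

definition seminorm_X ::
  "'a::euclidean_space set \<Rightarrow> ('a \<Rightarrow> 'a \<Rightarrow> real) \<Rightarrow> ('a \<Rightarrow> 'a \<Rightarrow> real \<Rightarrow> real) \<Rightarrow> ('a \<Rightarrow> real) \<Rightarrow> ennreal" where
  "seminorm_X \<Omega> s a u = luxemburg (\<lambda>c.
     \<integral>\<^sup>+(x, y)\<in>- ((- \<Omega>) \<times> (- \<Omega>)).
       ennreal (Phi a x y (\<bar>u x - u y\<bar> / (c * norm (x - y) powr s x y)) / norm (x - y) ^ DIM('a)) \<partial>lebesgue)"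

definition norm_Omega ::
  "'a::euclidean_space set \<Rightarrow> ('a \<Rightarrow> 'a \<Rightarrow> real \<Rightarrow> real) \<Rightarrow> ('a \<Rightarrow> real) \<Rightarrow> ennreal" where
  "norm_Omega \<Omega> a u = luxemburg (\<lambda>c. \<integral>\<^sup>+x\<in>\<Omega>. ennreal (Phi_hat a x (\<bar>u x\<bar> / c)) \<partial>lebesgue)"

definition norm_exterior ::
  "'a::euclidean_space set \<Rightarrow> ('a \<Rightarrow> real) \<Rightarrow> ('a \<Rightarrow> 'a \<Rightarrow> real \<Rightarrow> real) \<Rightarrow> ('a \<Rightarrow> real) \<Rightarrow> ennreal" where
  "norm_exterior \<Omega> \<beta> a u =
     luxemburg (\<lambda>c. \<integral>\<^sup>+x\<in>- \<Omega>. ennreal (\<beta> x * Phi_hat a x (\<bar>u x\<bar> / c)) \<partial>lebesgue)"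

text \<open>Elements are functions, not classes modulo equality almost everywhere.\<close>

definition X_space ::
  "'a::euclidean_space set \<Rightarrow> ('a \<Rightarrow> real) \<Rightarrow> ('a \<Rightarrow> 'a \<Rightarrow> real) \<Rightarrow> ('a \<Rightarrow> 'a \<Rightarrow> real \<Rightarrow> real) \<Rightarrow> ('a \<Rightarrow> real) set" where
  "X_space \<Omega> \<beta> s a =
     {u \<in> borel_measurable lebesgue. seminorm_X \<Omega> s a u + norm_Omega \<Omega> a u + norm_exterior \<Omega> \<beta> a u < \<infinity>}"

subsection \<open>Operators\<close>

definition frac_kernel ::
  "('a::euclidean_space \<Rightarrow> 'a \<Rightarrow> real) \<Rightarrow> ('a \<Rightarrow> 'a \<Rightarrow> real \<Rightarrow> real) \<Rightarrow> ('a \<Rightarrow> real) \<Rightarrow> 'a \<Rightarrow> 'a \<Rightarrow> real" where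
  "frac_kernel s a u x y =
     a x y (\<bar>u x - u y\<bar> / norm (x - y) powr s x y) *
     ((u x - u y) / norm (x - y) powr s x y) *
     (1 / norm (x - y) powr (real DIM('a) + s x y))"

definition truncated_laplacian ::
  "('a::euclidean_space \<Rightarrow> 'a \<Rightarrow> real) \<Rightarrow> ('a \<Rightarrow> 'a \<Rightarrow> real \<Rightarrow> real) \<Rightarrow> ('a \<Rightarrow> real) \<Rightarrow> real \<Rightarrow> 'a \<Rightarrow> real" where
  "truncated_laplacian s a u \<epsilon> x = (LINT y:(- ball x \<epsilon>)|lebesgue. frac_kernel s a u x y)"

definition fractional_laplacian ::
  "('a::euclidean_space \<Rightarrow> 'a \<Rightarrow> real) \<Rightarrow> ('a \<Rightarrow> 'a \<Rightarrow> real \<Rightarrow> real) \<Rightarrow> ('a \<Rightarrow> real) \<Rightarrow> 'a \<Rightarrow> real" where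
  "fractional_laplacian s a u x = Lim (at_right 0) (\<lambda>\<epsilon>. truncated_laplacian s a u \<epsilon> x)"

definition nonlocal_normal_derivative ::
  "'a::euclidean_space set \<Rightarrow> ('a \<Rightarrow> 'a \<Rightarrow> real) \<Rightarrow> ('a \<Rightarrow> 'a \<Rightarrow> real \<Rightarrow> real) \<Rightarrow> ('a \<Rightarrow> real) \<Rightarrow> 'a \<Rightarrow> real" where
  "nonlocal_normal_derivative \<Omega> s a u x = (LINT y:\<Omega>|lebesgue. frac_kernel s a u x y)"

end

theory Submission
  imports Defs
begin

text \<open>
  Split the truncated operator at \<open>x \<in> \<Omega>\<close> into its integrals over \<open>\<Omega>\<close> and over \<open>- \<Omega>\<close>. The kernel is
  antisymmetric and the truncation symmetric, so the first part integrates to zero over \<open>\<Omega>\<close>. The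
  second part converges by dominated convergence to the integral of the kernel over
  \<open>\<Omega> \<times> - \<Omega>\<close>, which by antisymmetry and Fubini is minus the integral of the normal derivative.
  The convergence in \<open>L\<^sup>1\<close> passes the left-hand side to the limit.
\<close>

section \<open>Fubini and coordinate swap for the completed measure\<close>

lemma integrable_lebesgue_cong_AE:
  fixes f g :: "'a::euclidean_space \<Rightarrow> real"
  assumes "integrable lebesgue f" and "AE x in lebesgue. f x = g x"
  shows "integrable lebesgue g" and "integral\<^sup>L lebesgue g = integral\<^sup>L lebesgue f"
proof -
  \<comment> \<open>Measurability survives a change on a null set because \<open>lebesgue\<close> is
    complete.\<close>
  have g: "g \<in> borel_measurable lebesgue"
    using borel_measurable_AE[OF borel_measurable_integrable[OF assms(1)] assms(2)] .
  show "integrable lebesgue g"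
    using integrable_cong_AE_imp[OF assms(1) g] assms(2) by (auto simp: eq_commute)
  show "integral\<^sup>L lebesgue g = integral\<^sup>L lebesgue f"
    using assms g by (intro integral_cong_AE) (auto simp: eq_commute)
qed

text \<open>\<open>lebesgue\<close> on a product space is the completion of the product of the
  \<open>lborel\<close> measures, so product theorems are applied to a Borel representative and
  carried back.\<close>

lemma integrable_lebesgue_borel_version:
  fixes f :: "'a::euclidean_space \<Rightarrow> real"
  assumes "integrable lebesgue f"
  obtains g where "integrable lborel g" and "AE x in lborel. f x = g x"
    and "integral\<^sup>L lebesgue f = integral\<^sup>L lborel g"
proof -
  obtain g where g: "g \<in> borel_measurable lborel" and eq: "AE x in lborel. f x = g x"
    using completion_ex_borel_measurable_real[OF borel_measurable_integrable[OF assms]] by blast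
  note * = integrable_lebesgue_cong_AE[OF assms AE_completion[OF eq]]
  show ?thesis
    using that[of g] g eq * integrable_completion[OF g] integral_completion[OF g] by simp
qed

text \<open>The null set where \<open>f\<close> differs from its Borel representative has null
  sections only over almost every \<open>x\<close>; hence the almost-everywhere form of the first
  claim.\<close>

lemma Fubini_lebesgue:
  fixes f :: "'a::euclidean_space \<times> 'b::euclidean_space \<Rightarrow> real"
  assumes "integrable lebesgue f"
  shows "AE x in lebesgue. integrable lebesgue (\<lambda>y. f (x, y))"
    and "integrable lebesgue (\<lambda>x. LINT y|lebesgue. f (x, y))"
    and "(LINT x|lebesgue. LINT y|lebesgue. f (x, y)) = integral\<^sup>L lebesgue f"
proof -
  obtain g where g: "integrable lborel g" and eq: "AE z in lborel. f z = g z"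
    and int: "integral\<^sup>L lebesgue f = integral\<^sup>L lborel g"
    using integrable_lebesgue_borel_version[OF assms] .
  have gp: "integrable (lborel \<Otimes>\<^sub>M lborel) g"
    using g by (simp add: lborel_prod)
  have "AE z in lborel \<Otimes>\<^sub>M lborel. f z = g z"
    using eq by (subst lborel_prod)
  then have "AE x in lborel. AE y in lborel. f (x, y) = g (x, y)"
    by (rule lborel_pair.AE_pair)
  moreover have "AE x in lborel. integrable lborel (\<lambda>y. g (x, y))"
    using lborel_pair.AE_integrable_fst'[OF gp] .
  ultimately have sect: "AE x in lborel. integrable lebesgue (\<lambda>y. f (x, y)) \<and>
      (LINT y|lborel. g (x, y)) = (LINT y|lebesgue. f (x, y))"
  proof eventually_elim
    case (elim x)
    have m: "(\<lambda>y. g (x, y)) \<in> borel_measurable lborel"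
      using elim by simp
    have "integrable lebesgue (\<lambda>y. g (x, y))"
      using elim integrable_completion[OF m] by simp
    moreover have "AE y in lebesgue. g (x, y) = f (x, y)"
      using elim(1) by (intro AE_completion) (auto simp: eq_commute)
    ultimately show ?case
      using integrable_lebesgue_cong_AE[of "\<lambda>y. g (x, y)" "\<lambda>y. f (x, y)"] integral_completion[OF m]
      by simp
  qed
  then show "AE x in lebesgue. integrable lebesgue (\<lambda>y. f (x, y))"
    by (intro AE_completion) auto
  have fst: "integrable lborel (\<lambda>x. LINT y|lborel. g (x, y))"
    using lborel_pair.integrable_fst'[OF gp] .
  then have fst': "integrable lebesgue (\<lambda>x. LINT y|lborel. g (x, y))"
    using integrable_completion[OF borel_measurable_integrable] by blast
  have "AE x in lebesgue. (LINT y|lborel. g (x, y)) = (LINT y|lebesgue. f (x, y))"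
    using sect by (intro AE_completion) auto
  note * = integrable_lebesgue_cong_AE[OF fst' this]
  show "integrable lebesgue (\<lambda>x. LINT y|lebesgue. f (x, y))"
    using * by simp
  show "(LINT x|lebesgue. LINT y|lebesgue. f (x, y)) = integral\<^sup>L lebesgue f"
    using * lborel_pair.integral_fst'[OF gp] int integral_completion[OF borel_measurable_integrable[OF fst]]
    by (simp add: lborel_prod)
qed

lemma lebesgue_product_swap:
  fixes f :: "'a::euclidean_space \<times> 'b::euclidean_space \<Rightarrow> real"
  assumes "integrable lebesgue f"
  shows "integrable lebesgue (\<lambda>(y, x). f (x, y))"
    and "(LINT z|lebesgue. (\<lambda>(y, x). f (x, y)) z) = integral\<^sup>L lebesgue f"
proof -
  obtain g where g: "integrable lborel g" and eq: "AE z in lborel. f z = g z"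
    and int: "integral\<^sup>L lebesgue f = integral\<^sup>L lborel g"
    using integrable_lebesgue_borel_version[OF assms] .
  have gp: "integrable (lborel \<Otimes>\<^sub>M lborel) g"
    using g by (simp add: lborel_prod)
  define h where "h = (\<lambda>(y, x). g (x, y))"
  have h: "integrable lborel h"
    using lborel_pair.integrable_product_swap[OF gp] by (simp add: h_def lborel_prod)
  \<comment> \<open>The swap preserves \<open>lborel\<close>, so the null set where \<open>f\<close>
    and \<open>g\<close> differ pulls back to a null set.\<close>
  have swap: "(lborel :: ('a \<times> 'b) measure) = distr lborel lborel (\<lambda>(y, x). (x, y))"
    using lborel_pair.distr_pair_swap[where 'b='b and 'a='a] by (simp add: lborel_prod)
  have "AE z in distr lborel lborel (\<lambda>(y::'b, x::'a). (x, y)). f z = g z"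
    using eq by (subst swap[symmetric])
  then have "AE z in lborel. f ((\<lambda>(y::'b, x::'a). (x, y)) z) = g ((\<lambda>(y, x). (x, y)) z)"
    by (rule AE_distrD[rotated]) (simp add: lborel_prod[symmetric] measurable_pair_swap')
  then have "AE z in lebesgue. h z = (\<lambda>(y, x). f (x, y)) z"
    unfolding h_def by (intro AE_completion) (auto simp: case_prod_beta)
  moreover have "integrable lebesgue h"
    using h integrable_completion[OF borel_measurable_integrable[OF h]] by simp
  ultimately have *: "integrable lebesgue (\<lambda>(y, x). f (x, y))"
      "(LINT z|lebesgue. (\<lambda>(y, x). f (x, y)) z) = integral\<^sup>L lebesgue h"
    using integrable_lebesgue_cong_AE by blast+
  show "integrable lebesgue (\<lambda>(y, x). f (x, y))"
    by fact
  have "integral\<^sup>L lebesgue h = integral\<^sup>L lborel h"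
    using integral_completion[OF borel_measurable_integrable[OF h]] .
  also have "\<dots> = integral\<^sup>L lborel g"
    using lborel_pair.integral_product_swap[OF borel_measurable_integrable[OF gp]]
    by (simp add: h_def lborel_prod)
  finally show "(LINT z|lebesgue. (\<lambda>(y, x). f (x, y)) z) = integral\<^sup>L lebesgue f"
    using * int by simp
qed

section \<open>Integrating the principal value of an antisymmetric kernel\<close>

text \<open>On \<open>\<Omega> \<times> \<Omega>\<close> only the truncations of \<open>k\<close>
  are assumed integrable, so the cancellation is made for each truncation, before the limit;
  \<open>L1\<close> then carries the identity over to \<open>L\<close>.\<close>

lemma principal_value_integral_antisymmetric:
  fixes k :: "'a::euclidean_space \<Rightarrow> 'a \<Rightarrow> real" and L :: "'a \<Rightarrow> real" and \<Omega> :: "'a set"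
  defines "T \<equiv> \<lambda>\<epsilon> x. LINT y:(- ball x \<epsilon>)|lebesgue. k x y"
  assumes anti: "\<And>x y. k y x = - k x y"
    and trunc: "\<And>\<epsilon>. \<epsilon> > 0 \<Longrightarrow>
      set_integrable lebesgue {(x, y) \<in> \<Omega> \<times> \<Omega>. \<epsilon> \<le> dist x y} (\<lambda>(x, y). k x y)"
    and ext: "set_integrable lebesgue ((- \<Omega>) \<times> \<Omega>) (\<lambda>(x, y). k x y)"
    and pv: "AE x in lebesgue. x \<in> \<Omega> \<longrightarrow> ((\<lambda>\<epsilon>. T \<epsilon> x) \<longlongrightarrow> L x) (at_right 0)"
    and L1: "((\<lambda>\<epsilon>. \<integral>\<^sup>+x\<in>\<Omega>. ennreal \<bar>T \<epsilon> x - L x\<bar> \<partial>lebesgue) \<longlongrightarrow> 0) (at_right 0)"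
  shows "(LINT x:\<Omega>|lebesgue. L x) = - (LINT x:(- \<Omega>)|lebesgue. LINT y:\<Omega>|lebesgue. k x y)"
proof -
  \<comment> \<open>\<open>F \<epsilon>\<close> and \<open>G' \<epsilon>\<close> are the parts of
    the truncated kernel over \<open>\<Omega> \<times> \<Omega>\<close> and
    \<open>\<Omega> \<times> (- \<Omega>)\<close>; \<open>H\<close> is the mirror image of
    \<open>G\<close> up to sign and belongs to the normal derivative.\<close>
  define D where "D \<epsilon> = {z :: 'a \<times> 'a. \<epsilon> \<le> dist (fst z) (snd z)}" for \<epsilon>
  define F where "F \<epsilon> = (\<lambda>(x, y). indicator {(x, y) \<in> \<Omega> \<times> \<Omega>. \<epsilon> \<le> dist x y} (x, y) * k x y)" for \<epsilon>
  define G where "G = (\<lambda>(x, y). indicator (\<Omega> \<times> (- \<Omega>)) (x, y) * k x y)"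
  define H where "H = (\<lambda>(x, y). indicator ((- \<Omega>) \<times> \<Omega>) (x, y) * k x y)"
  define G' where "G' \<epsilon> z = indicator (D \<epsilon>) z * G z" for \<epsilon> z
  \<comment> \<open>The limit is taken along 1/(n+1), since dominated convergence and measurability
    of pointwise limits are facts about sequences; positivity keeps it within
    \<open>at_right 0\<close>.\<close>
  define e where "e n = inverse (real (Suc n))" for n
  define A where "A n x = indicator \<Omega> x * T (e n) x" for n x
  define B where "B x = indicator \<Omega> x * L x" for x

  have e_pos: "e n > 0" for n
    by (simp add: e_def)
  have e_0: "e \<longlonglongrightarrow> 0"
    using LIMSEQ_inverse_real_of_nat by (simp add: e_def [abs_def])
  then have e_lim: "filterlim e (at_right 0) sequentially"
    using e_pos by (auto simp: filterlim_at less_imp_neq[symmetric])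
  have "closed (D \<epsilon>)" for \<epsilon>
    unfolding D_def by (intro closed_Collect_le continuous_intros)
  then have D: "D \<epsilon> \<in> sets lebesgue" for \<epsilon>
    by (simp add: borel_closed)

  have F: "integrable lebesgue (F (e n))" for n
  proof -
    have "F (e n) = (\<lambda>z. indicator {(x, y) \<in> \<Omega> \<times> \<Omega>. e n \<le> dist x y} z *\<^sub>R (case z of (x, y) \<Rightarrow> k x y))"
      by (simp add: F_def fun_eq_iff)
    then show ?thesis
      using trunc[OF e_pos[of n]] by (simp only: set_integrable_def)
  qed
  \<comment> \<open>The truncated region is symmetric, so the swap sends \<open>F \<epsilon>\<close>
    to its negative; for each \<open>e n\<close> the integral equals minus itself and
    vanishes.\<close>
  have "(\<lambda>(y, x). F \<epsilon> (x, y)) = (\<lambda>z. - F \<epsilon> z)" for \<epsilon>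
  proof
    fix z :: "'a \<times> 'a"
    obtain x y where "z = (y, x)"
      by fastforce
    then show "(case z of (y, x) \<Rightarrow> F \<epsilon> (x, y)) = - F \<epsilon> z"
      by (simp add: F_def anti[of x y] indicator_def dist_commute)
  qed
  then have F0: "integral\<^sup>L lebesgue (F (e n)) = 0" for n
    using lebesgue_product_swap(2)[OF F[of n]] by simp

  have H: "integrable lebesgue H"
  proof -
    have "H = (\<lambda>z. indicator ((- \<Omega>) \<times> \<Omega>) z *\<^sub>R (case z of (x, y) \<Rightarrow> k x y))"
      by (simp add: H_def fun_eq_iff)
    then show ?thesis
      using ext by (simp only: set_integrable_def)
  qed
  \<comment> \<open>This reflection yields both the integrability of \<open>G\<close> and the minus
    sign of the claim.\<close>
  have HG: "(\<lambda>(y, x). H (x, y)) = (\<lambda>z. - G z)"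
  proof
    fix z :: "'a \<times> 'a"
    obtain x y where "z = (y, x)"
      by fastforce
    then show "(case z of (y, x) \<Rightarrow> H (x, y)) = - G z"
      by (auto simp: G_def H_def anti[of x y] indicator_def)
  qed
  have G: "integrable lebesgue G" and G_H: "integral\<^sup>L lebesgue G = - integral\<^sup>L lebesgue H"
    using lebesgue_product_swap[OF H] unfolding HG by auto
  have G': "integrable lebesgue (G' \<epsilon>)" for \<epsilon>
    unfolding G'_def using integrable_mult_indicator[OF D G] by simp
  have "(\<lambda>n. integral\<^sup>L lebesgue (G' (e n))) \<longlonglongrightarrow> integral\<^sup>L lebesgue G"
  proof (rule integral_dominated_convergence[where w="\<lambda>z. norm (G z)"])
    show "AE z in lebesgue. (\<lambda>n. G' (e n) z) \<longlonglongrightarrow> G z"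
    proof (rule AE_I2)
      fix z :: "'a \<times> 'a"
      \<comment> \<open>On the diagonal \<open>G\<close> vanishes, as no point lies both in
        \<open>\<Omega>\<close> and outside it; off the diagonal the truncation is eventually
        inactive.\<close>
      show "(\<lambda>n. G' (e n) z) \<longlonglongrightarrow> G z"
      proof (cases "fst z = snd z")
        case True
        then show ?thesis
          by (auto simp: G'_def G_def case_prod_beta indicator_def)
      next
        case False
        then have "\<forall>\<^sub>F n in sequentially. e n < dist (fst z) (snd z)"
          using e_0 by (intro order_tendstoD) auto
        then have "\<forall>\<^sub>F n in sequentially. G' (e n) z = G z"
          by eventually_elim (simp add: G'_def D_def)
        then show ?thesis
          by (rule tendsto_eventually)
      qed
    qed
  qed (use G G' in \<open>auto simp: G'_def indicator_def\<close>)
  moreover have A: "integrable lebesgue (A n)"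
      and A_int: "integral\<^sup>L lebesgue (A n) = integral\<^sup>L lebesgue (G' (e n))" for n
  proof -
    have FG: "integrable lebesgue (\<lambda>z. F (e n) z + G' (e n) z)"
      using F G' by simp
    have "(LINT y|lebesgue. F (e n) (x, y) + G' (e n) (x, y)) = A n x" for x
    proof (cases "x \<in> \<Omega>")
      case True
      \<comment> \<open>The ball is open, so its complement matches the non-strict inequality in
        \<open>D\<close>; \<open>F\<close> covers the \<open>y\<close> in \<open>\<Omega>\<close>
        and \<open>G'\<close> the others.\<close>
      then have "F (e n) (x, y) + G' (e n) (x, y) = indicator (- ball x (e n)) y * k x y" for y
        by (auto simp: F_def G'_def G_def D_def indicator_def)
      then show ?thesis
        using True by (simp add: A_def T_def set_lebesgue_integral_def)
    qed (simp add: F_def G'_def G_def A_def)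
    then show "integrable lebesgue (A n)" "integral\<^sup>L lebesgue (A n) = integral\<^sup>L lebesgue (G' (e n))"
      using Fubini_lebesgue(2,3)[OF FG] F[of n] G'[of "e n"] F0[of n] by simp_all
  qed
  ultimately have lim_G: "(\<lambda>n. integral\<^sup>L lebesgue (A n)) \<longlonglongrightarrow> integral\<^sup>L lebesgue G"
    by simp

  have A_B: "(\<lambda>n. \<integral>\<^sup>+x. ennreal (norm (A n x - B x)) \<partial>lebesgue) \<longlonglongrightarrow> 0"
  proof -
    have "ennreal \<bar>T (e n) x - L x\<bar> * indicator \<Omega> x = ennreal (norm (A n x - B x))" for n x
      by (simp add: A_def B_def indicator_def)
    with filterlim_compose[OF L1 e_lim] show ?thesis
      by simp
  qed
  have B: "integrable lebesgue B"
  proof -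
    \<comment> \<open>The integral in \<open>L1\<close> is defined for non-measurable integrands as
      well, so measurability of \<open>B\<close> comes instead from its being an almost-everywhere
      limit of the \<open>A n\<close>.\<close>
    have "AE x in lebesgue. (\<lambda>n. A n x) \<longlonglongrightarrow> B x"
      using pv
    proof eventually_elim
      case (elim x)
      show ?case
      proof (cases "x \<in> \<Omega>")
        case True
        with elim filterlim_compose[OF _ e_lim, of "\<lambda>\<epsilon>. T \<epsilon> x" "nhds (L x)"] show ?thesis
          by (simp add: A_def B_def)
      qed (simp add: A_def B_def)
    qed
    then have "AE x in lebesgue. lim (\<lambda>n. A n x) = B x"
      by eventually_elim (rule limI)
    moreover have "(\<lambda>x. lim (\<lambda>n. A n x)) \<in> borel_measurable lebesgue"
      using A by (intro borel_measurable_lim_metric) auto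
    ultimately have meas: "B \<in> borel_measurable lebesgue"
      using borel_measurable_AE by blast
    \<comment> \<open>Any finite bound would do in place of 1: \<open>B\<close> is integrable once
      \<open>A n\<close> and one difference \<open>A n x - B x\<close> are.\<close>
    obtain n where n: "(\<integral>\<^sup>+x. ennreal (norm (A n x - B x)) \<partial>lebesgue) < 1"
      using order_tendstoD(2)[OF A_B, of 1] by (auto simp: eventually_sequentially)
    have "integrable lebesgue (\<lambda>x. A n x - B x)"
      using A[of n] meas order_less_trans[OF n ennreal_one_less_top]
      by (intro integrableI_bounded) auto
    from Bochner_Integration.integrable_diff[OF A[of n] this] show ?thesis
      by simp
  qed
  \<comment> \<open>The integrals of \<open>A n\<close> now have two limits, the integrals of
    \<open>G\<close> and of \<open>B\<close>, which must coincide.\<close>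
  have "(\<lambda>n. integral\<^sup>L lebesgue (A n)) \<longlonglongrightarrow> integral\<^sup>L lebesgue B"
    using tendsto_L1_int[OF A B A_B] .
  then have "integral\<^sup>L lebesgue B = - integral\<^sup>L lebesgue H"
    using lim_G G_H LIMSEQ_unique by metis
  also have "integral\<^sup>L lebesgue H = (LINT x:(- \<Omega>)|lebesgue. LINT y:\<Omega>|lebesgue. k x y)"
    by (subst Fubini_lebesgue(3)[OF H, symmetric])
      (simp add: H_def set_lebesgue_integral_def indicator_times mult.assoc)
  finally show ?thesis
    by (simp add: B_def [abs_def] set_lebesgue_integral_def)
qed

section \<open>Application to the fractional kernel\<close>

text \<open>Every factor is symmetric in \<open>x\<close> and \<open>y\<close> except the one
  containing \<open>u x - u y\<close>, which changes sign.\<close>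

lemma frac_kernel_antisym:
  assumes "\<And>x y. s x y = s y x" and "\<And>x y t. a x y t = a y x t"
  shows "frac_kernel s a u y x = - frac_kernel s a u x y"
proof -
  have "u y - u x = - (u x - u y)"
    by simp
  then show ?thesis
    unfolding frac_kernel_def
    by (simp only: assms(1)[of y x] assms(2)[of y x] norm_minus_commute[of y x] abs_minus_cancel
        minus_divide_left [symmetric] mult_minus_left mult_minus_right)
qed

text \<open>The four named assumptions are hypotheses stated in addition to membership of
  \<open>u\<close> in \<open>X_space\<close>. A non-integrable function has integral 0 and
  \<open>Lim\<close> is total, so the equation alone does not assert that its integrals and limits
  exist. \<open>principal_value_in_L1\<close> exchanges the limit with the integral over
  \<open>\<Omega>\<close>.\<close>

theorem proposition3p5:
  fixes \<Omega> :: "'a::euclidean_space set"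
    and \<beta> u :: "'a \<Rightarrow> real"
    and s :: "nat \<Rightarrow> 'a \<Rightarrow> 'a \<Rightarrow> real"
    and a :: "nat \<Rightarrow> 'a \<Rightarrow> 'a \<Rightarrow> real \<Rightarrow> real"
    and lo hi :: "nat \<Rightarrow> real"
    and i :: nat
  assumes "open \<Omega>" and "bounded \<Omega>" and "lipschitz_boundary \<Omega>"
    and "bounded_weight (- \<Omega>) \<beta>"
    and "\<And>j. j \<in> {1, 2} \<Longrightarrow> fractional_order (s j)"
    and "\<And>j. j \<in> {1, 2} \<Longrightarrow> growth_conditions (a j) (lo j) (hi j)"
    and "i \<in> {1, 2}"
    and "u \<in> X_space \<Omega> \<beta> (s i) (a i)"
    and truncated_integrals_exist:
      "\<And>\<epsilon>. \<epsilon> > 0 \<Longrightarrow> set_integrable lebesgue {(x, y) \<in> \<Omega> \<times> \<Omega>. \<epsilon> \<le> dist x y}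
         (\<lambda>(x, y). frac_kernel (s i) (a i) u x y)"
    and normal_derivative_integral_exists:
      "set_integrable lebesgue ((- \<Omega>) \<times> \<Omega>) (\<lambda>(x, y). frac_kernel (s i) (a i) u x y)"
    and principal_value_exists:
      "AE x in lebesgue_on \<Omega>. \<exists>l. ((\<lambda>\<epsilon>. truncated_laplacian (s i) (a i) u \<epsilon> x) \<longlongrightarrow> l) (at_right 0)"
    and principal_value_in_L1:
      "((\<lambda>\<epsilon>. \<integral>\<^sup>+x\<in>\<Omega>. ennreal \<bar>truncated_laplacian (s i) (a i) u \<epsilon> x
           - fractional_laplacian (s i) (a i) u x\<bar> \<partial>lebesgue) \<longlongrightarrow> 0) (at_right 0)"
  shows "(LINT x:\<Omega>|lebesgue. fractional_laplacian (s i) (a i) u x) =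
         - (LINT x:(- \<Omega>)|lebesgue. nonlocal_normal_derivative \<Omega> (s i) (a i) u x)"
proof -
  have "fractional_order (s i)" and "growth_conditions (a i) (lo i) (hi i)"
    using assms(5-7) by blast+
  then have anti: "frac_kernel (s i) (a i) u y x = - frac_kernel (s i) (a i) u x y" for x y
    unfolding fractional_order_def growth_conditions_def by (intro frac_kernel_antisym) blast+
  have "\<Omega> \<in> sets lebesgue"
    using \<open>open \<Omega>\<close> by simp
  then have "AE x in lebesgue. x \<in> \<Omega> \<longrightarrow>
      (\<exists>l. ((\<lambda>\<epsilon>. truncated_laplacian (s i) (a i) u \<epsilon> x) \<longlongrightarrow> l) (at_right 0))"
    using principal_value_exists by (simp add: AE_restrict_space_iff)
  \<comment> \<open>\<open>Lim\<close> is a choice operator: it is known to be the limit only at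
    points where a limit exists.\<close>
  then have "AE x in lebesgue. x \<in> \<Omega> \<longrightarrow> ((\<lambda>\<epsilon>. truncated_laplacian (s i) (a i) u \<epsilon> x)
      \<longlongrightarrow> fractional_laplacian (s i) (a i) u x) (at_right 0)"
    by eventually_elim (auto simp: fractional_laplacian_def tendsto_Lim)
  from principal_value_integral_antisymmetric[OF anti truncated_integrals_exist
      normal_derivative_integral_exists this[unfolded truncated_laplacian_def]
      principal_value_in_L1[unfolded truncated_laplacian_def]]
  show ?thesis
    by (simp add: nonlocal_normal_derivative_def)
qed

end
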